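(* Let $m$ be a fixed positive integer, $p\in(0,1)$, $q=1-p$ and $\rho=p/q$. The asymptotic probability (as $n\to\infty$ with $p$ fixed) that a random graph $g$ in the Erdős–Rényi model $G(n,p)$ has $m$ connected components satisfies $$\mathbb P(g\text{ has }m\text{ connected components})\approx\sum_{k\ge0}P_{k,m}(\rho)\cdot\binom nk\cdot\frac{q^{nk}}{q^{k(k+1)/2}},$$ where $$P_{k,m}(\rho)=\sum_{g'\in\mathcal G_k}(-1)^{\pi_0(g')-(m-1)}\binom{\pi_0(g')}{m-1}w(g')$$ and $\pi_0(g')$ is the number of connected components of the graph $g'$.
   Context: $G(n,p)$ is the random labeled simple graph with vertex set $[n]=\{1,\dots,n\}$ in which each pair of distinct vertices is joined by an edge independently with probability $p$. $\mathcal G_k$ is the set of all labeled simple graphs with vertex set $[k]$ (for $k=0$ there is exactly one, the empty graph, with $\pi_0=0$). The weight of a graph $g'$ is $w(g')=\rho^{|E(g')|}$, where $|E(g')|$ is its number of edges. Notation $\approx$: $p_n\approx\sum_{k\ge0}c_kg_k(n)$ (here $g_k(n)=\binom nk q^{nk-k(k+1)/2}$) means that $g_{k+1}(n)=o(g_k(n))$ for every $k$ and, for every integer $r\ge0$, $p_n=\sum_{k=0}^rc_kg_k(n)+O(g_{r+1}(n))$ as $n\to\infty$. *)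

theory Defs
  imports "HOL-Probability.Probability" "HOL-Probability.Product_PMF"
    "HOL-Library.Landau_Symbols"
begin

text \<open>A graph is a pair of its vertex set and its edge set; the edges of a simple graph are
  two-element sets of vertices.\<close>

type_synonym 'a graph = "'a set \<times> 'a set set"

definition vertex_pairs :: "'a set \<Rightarrow> 'a set set" where
  "vertex_pairs V = {e. e \<subseteq> V \<and> card e = 2}"

definition labeled_graphs :: "nat \<Rightarrow> nat graph set" where
  "labeled_graphs k = {(V, E). V = {1..k} \<and> E \<subseteq> vertex_pairs V}"

definition connection_rel :: "'a graph \<Rightarrow> ('a \<times> 'a) set" where
  "connection_rel g = {(u, v). u \<in> fst g \<and> v \<in> fst g \<and> (u, v) \<in> {(x, y). {x, y} \<in> snd g}\<^sup>*}"

definition connected_components :: "'a graph \<Rightarrow> 'a set set" where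
  "connected_components g = fst g // connection_rel g"

definition pi0 :: "'a graph \<Rightarrow> nat" where
  "pi0 g = card (connected_components g)"

text \<open>The family of indicators of the edges is drawn from the product of Bernoulli distributions
  over all pairs of distinct vertices (\<open>False\<close> is only the default value outside of that index set).\<close>

definition erdos_renyi :: "nat \<Rightarrow> real \<Rightarrow> nat graph pmf" where
  "erdos_renyi n p =
     map_pmf (\<lambda>X. ({1..n}, {e \<in> vertex_pairs {1..n}. X e}))
       (Pi_pmf (vertex_pairs {1..n}) False (\<lambda>_. bernoulli_pmf p))"

definition weight :: "real \<Rightarrow> 'a graph \<Rightarrow> real" where
  "weight \<rho> g = \<rho> ^ card (snd g)"

text \<open>The exponent of \<open>-1\<close> is an integer, as \<open>pi0 g\<close> may be smaller than \<open>m - 1\<close>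
  (the binomial coefficient then vanishes).\<close>

definition P_coeff :: "nat \<Rightarrow> nat \<Rightarrow> real \<Rightarrow> real" where
  "P_coeff k m \<rho> =
     (\<Sum>g\<in>labeled_graphs k.
        (-1) powi (int (pi0 g) - (int m - 1)) * real (pi0 g choose (m - 1)) * weight \<rho> g)"

definition asymp_expansion :: 
  "(nat \<Rightarrow> real) \<Rightarrow> (nat \<Rightarrow> real) \<Rightarrow> (nat \<Rightarrow> nat \<Rightarrow> real) \<Rightarrow> bool" where
  "asymp_expansion f c g \<longleftrightarrow>
     (\<forall>k. g (Suc k) \<in> o(g k)) \<and>
     (\<forall>r. (\<lambda>n. f n - (\<Sum>k\<le>r. c k * g k n)) \<in> O(g (Suc r)))"

end

theory Submission
  imports Defs
begin

text \<open>A set \<open>S\<close> of \<open>k\<close> vertices spans a given graph \<open>g'\<close> and sends no edge to its complement with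
  probability \<open>w(g') q\<^sup>n\<^sup>k / q\<^bsup>k(k+1)/2\<^esup>\<close>.  Hence the sum truncated at \<open>r\<close> is the expectation of the sum of
  \<open>(-1)\<^bsup>j-(m-1)\<^esup> binom j (m-1)\<close> over the unions \<open>S\<close> of components with \<open>|S| \<le> r\<close>, where \<open>j\<close> is the number
  of components in \<open>S\<close>.  If some component misses at most \<open>r\<close> vertices, these unions are exactly
  those of the other \<open>\<pi>\<^sub>0 - 1\<close> components, and binomial inversion turns the inner sum into the indicator
  of \<open>\<pi>\<^sub>0 = m\<close>.  Otherwise some union of components has between \<open>r + 1\<close> and \<open>n/2\<close> vertices, an event of
  probability at most a polynomial in \<open>n\<close> times \<open>q\<^bsup>(r+1)n\<^esup>\<close>, and the inner sum is polynomially bounded.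
  The factor \<open>q\<^sup>n\<close> absorbs all polynomials, so that the truncation at \<open>r\<close> has error \<open>O(g\<^sub>r)\<close>; using this
  for \<open>r + 1\<close> yields the required \<open>O(g\<^bsub>r+1\<^esub>)\<close>.\<close>

section \<open>Components and separated vertex sets\<close>

lemma vertex_pairs_mono: "S \<subseteq> V \<Longrightarrow> vertex_pairs S \<subseteq> vertex_pairs V"
  by (auto simp: vertex_pairs_def)

lemma finite_vertex_pairs [simp]: "finite V \<Longrightarrow> finite (vertex_pairs V)"
  by (rule finite_subset[of _ "Pow V"]) (auto simp: vertex_pairs_def)

lemma card_vertex_pairs: "finite V \<Longrightarrow> card (vertex_pairs V) = card V choose 2"
  unfolding vertex_pairs_def by (rule n_subsets)

lemma vertex_pairs_disjoint: "S \<inter> T = {} \<Longrightarrow> vertex_pairs S \<inter> vertex_pairs T = {}"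
  unfolding vertex_pairs_def by (auto dest: Int_greatest)

lemma doubleton_in_vertex_pairs_iff: "{x, y} \<in> vertex_pairs V \<longleftrightarrow> x \<in> V \<and> y \<in> V \<and> x \<noteq> y"
  by (auto simp: vertex_pairs_def card_insert_if)

lemma vertex_pairs_cases:
  assumes "e \<in> vertex_pairs V"
  obtains x y where "e = {x, y}" "x \<in> V" "y \<in> V" "x \<noteq> y"
  using assms by (auto simp: vertex_pairs_def card_2_iff)

abbreviation adjacent :: "'a set set \<Rightarrow> ('a \<times> 'a) set" where
  "adjacent E \<equiv> {(x, y). {x, y} \<in> E}"

lemma equiv_connection_rel: "equiv V (connection_rel (V, E))"
proof (rule equivI)
  have "sym ((adjacent E)\<^sup>*)"
    by (rule sym_rtrancl) (auto simp: sym_def insert_commute)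
  then show "sym (connection_rel (V, E))"
    by (auto simp: connection_rel_def sym_def)
qed (auto simp: connection_rel_def refl_on_def trans_def intro: rtrancl_trans)

lemma Union_connected_components [simp]: "\<Union> (connected_components (V, E)) = V"
  using Union_quotient[OF equiv_connection_rel] by (simp add: connected_components_def)

lemma finite_connected_components [simp]: "finite V \<Longrightarrow> finite (connected_components (V, E))"
  unfolding connected_components_def fst_conv
  by (rule finite_quotient) (auto simp: connection_rel_def)

lemma empty_notin_connected_components: "{} \<notin> connected_components (V, E)"
  unfolding connected_components_def
  by (metis equiv_connection_rel fst_conv in_quotient_imp_non_empty)

lemma connected_components_disjoint:
  "C \<in> connected_components (V, E) \<Longrightarrow> D \<in> connected_components (V, E) \<Longrightarrow> C \<noteq> D \<Longrightarrow> C \<inter> D = {}"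
  unfolding connected_components_def
  by (metis equiv_connection_rel fst_conv quotient_disj)

lemma pi0_le_card: "finite V \<Longrightarrow> pi0 (V, E) \<le> card V"
  unfolding pi0_def connected_components_def quotient_def fst_conv
  by (simp add: UNION_singleton_eq_range card_image_le)

section \<open>Vertex sets that are unions of components\<close>

text \<open>Phrased through pairs inside \<open>S\<close> and pairs inside \<open>V - S\<close>: for
  fixed \<open>S\<close> the admissible \<open>E\<close> then form the power set of a disjoint
  union, and weighted sums over them factor.\<close>

definition separated :: "'a set \<Rightarrow> 'a set set \<Rightarrow> 'a set \<Rightarrow> bool" where
  "separated V E S \<longleftrightarrow> S \<subseteq> V \<and> E \<subseteq> vertex_pairs S \<union> vertex_pairs (V - S)"

lemma separated_compl: "separated V E S \<Longrightarrow> separated V E (V - S)"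
  by (auto simp: separated_def double_diff)

lemma separated_adjacent:
  "separated V E S \<Longrightarrow> {x, y} \<in> E \<Longrightarrow> x \<in> S \<longleftrightarrow> y \<in> S"
  by (auto simp: separated_def doubleton_in_vertex_pairs_iff subset_iff)

text \<open>No edge leaves \<open>S\<close>, so by induction a path that starts in \<open>S\<close>
  stays there and uses only pairs inside \<open>S\<close>. Hence the graph induced on
  \<open>S\<close> has the same classes as the whole graph.\<close>

lemma separated_rtrancl:
  assumes sep: "separated V E S" and "(x, y) \<in> (adjacent E)\<^sup>*" "x \<in> S"
  shows "(x, y) \<in> (adjacent (E \<inter> vertex_pairs S))\<^sup>* \<and> y \<in> S"
  using assms(2)
proof (induction rule: rtrancl_induct)
  case base
  then show ?case using assms(3) by simp
next
  case (step y z)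
  then have z: "z \<in> S" using separated_adjacent[OF sep, of y z] by auto
  have "{y, z} \<in> vertex_pairs S \<union> vertex_pairs (V - S)"
    using sep step by (auto simp: separated_def)
  then have "{y, z} \<in> vertex_pairs S"
    using z by (auto simp: doubleton_in_vertex_pairs_iff)
  then show ?case using step z by (auto intro: rtrancl_into_rtrancl)
qed

lemma connection_rel_separated:
  assumes "separated V E S" "x \<in> S"
  shows "connection_rel (S, E \<inter> vertex_pairs S) `` {x} = connection_rel (V, E) `` {x}"
proof -
  have "(adjacent (E \<inter> vertex_pairs S))\<^sup>* \<subseteq> (adjacent E)\<^sup>*"
    by (rule rtrancl_mono) auto
  then show ?thesis
    using assms separated_rtrancl[OF assms(1)]
    by (auto simp: connection_rel_def separated_def)
qed

lemma connected_components_separated: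
  assumes "separated V E S"
  shows "connected_components (S, E \<inter> vertex_pairs S) = (\<lambda>x. connection_rel (V, E) `` {x}) ` S"
  using connection_rel_separated[OF assms]
  by (auto simp: connected_components_def quotient_def)

lemma separated_Union:
  assumes E: "E \<subseteq> vertex_pairs V" and A: "A \<subseteq> connected_components (V, E)"
  shows "separated V E (\<Union> A)"
proof -
  have AV: "\<Union> A \<subseteq> V" using A Union_connected_components[of V E] by blast
  have cl: "y \<in> \<Union> A" if x: "x \<in> \<Union> A" and xyE: "{x, y} \<in> E" for x y
  proof -
    have xy: "(x, y) \<in> connection_rel (V, E)"
      using xyE E by (auto simp: connection_rel_def doubleton_in_vertex_pairs_iff subset_iff)
    obtain C where C: "C \<in> A" "x \<in> C" using x by blast
    have "C \<in> V // connection_rel (V, E)" using A C by (auto simp: connected_components_def)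
    then have "y \<in> C"
      using in_quotient_imp_closed[OF equiv_connection_rel] C xy by metis
    then show ?thesis using C by blast
  qed
  have "e \<in> vertex_pairs (\<Union> A) \<union> vertex_pairs (V - \<Union> A)" if e: "e \<in> E" for e
  proof -
    have "e \<in> vertex_pairs V" using e E by blast
    then obtain x y where xy: "e = {x, y}" "x \<in> V" "y \<in> V" "x \<noteq> y"
      by (rule vertex_pairs_cases)
    then show ?thesis
      using cl[of x y] cl[of y x] e
      by (auto simp: doubleton_in_vertex_pairs_iff insert_commute simp del: Union_iff)
  qed
  then show ?thesis using AV by (auto simp: separated_def)
qed

lemma connected_components_Union:
  assumes E: "E \<subseteq> vertex_pairs V" and A: "A \<subseteq> connected_components (V, E)"
  shows "connected_components (\<Union> A, E \<inter> vertex_pairs (\<Union> A)) = A"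
proof -
  have q: "C \<in> V // connection_rel (V, E)" if "C \<in> A" for C
    using that A by (auto simp: connected_components_def)
  have eq: "connection_rel (V, E) `` {x} = C" if C: "C \<in> A" and x: "x \<in> C" for x C
  proof -
    obtain y where y: "C = connection_rel (V, E) `` {y}"
      using q[OF C] by (rule quotientE)
    with x show ?thesis
      using equiv_class_eq[OF equiv_connection_rel, of y x V E] by simp
  qed
  have ne: "C \<noteq> {}" if "C \<in> A" for C
    using that A empty_notin_connected_components by blast
  show ?thesis
    unfolding connected_components_separated[OF separated_Union[OF E A]]
  proof (intro equalityI subsetI)
    fix C assume C: "C \<in> A"
    then obtain x where "x \<in> C" using ne by blast
    then show "C \<in> (\<lambda>x. connection_rel (V, E) `` {x}) ` \<Union> A" using eq[OF C] C by blast
  qed (use eq in auto)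
qed

text \<open>The inverse sends \<open>S\<close> to the components of the graph induced on
  \<open>S\<close>. Sums over separated sets thus become sums over sets of components, where
  \<open>pi0\<close> of the induced graph is a cardinality.\<close>

lemma bij_betw_Union_separated:
  assumes E: "E \<subseteq> vertex_pairs V"
  shows "bij_betw Union (Pow (connected_components (V, E))) {S. separated V E S}"
proof (rule bij_betw_byWitness[where f' = "\<lambda>S. connected_components (S, E \<inter> vertex_pairs S)"])
  show "(\<lambda>S. connected_components (S, E \<inter> vertex_pairs S)) ` {S. separated V E S}
          \<subseteq> Pow (connected_components (V, E))"
    by (auto simp: connected_components_separated)
       (auto simp: connected_components_def quotient_def separated_def)
qed (use E in \<open>auto simp: connected_components_Union intro: separated_Union\<close>)

lemma pi0_Union:
  assumes "E \<subseteq> vertex_pairs V" "A \<subseteq> connected_components (V, E)"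
  shows "pi0 (\<Union> A, E \<inter> vertex_pairs (\<Union> A)) = card A"
  using connected_components_Union[OF assms] by (simp add: pi0_def)

section \<open>Invariance under relabelling of the vertices\<close>

lemma rtrancl_adjacent_image:
  assumes "(x, y) \<in> (adjacent E)\<^sup>*"
  shows "(f x, f y) \<in> (adjacent ((`) f ` E))\<^sup>*"
  using assms
proof (induction rule: rtrancl_induct)
  case (step y z)
  then have "(f y, f z) \<in> adjacent ((`) f ` E)" by (auto intro!: image_eqI[of _ _ "{y, z}"])
  then show ?case using step by (meson rtrancl.rtrancl_into_rtrancl)
qed simp

text \<open>Paths are carried forward by \<open>f\<close> and back by \<open>inv_into V f\<close>,
  so \<open>f\<close> maps classes bijectively to classes.\<close>

lemma pi0_image:
  assumes inj: "inj_on f V" and E: "E \<subseteq> vertex_pairs V"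
  shows "pi0 (f ` V, (`) f ` E) = pi0 (V, E)"
proof -
  let ?g = "inv_into V f"
  have gf: "?g ` f ` e = e" if "e \<in> E" for e
    using that E inj by (intro inv_into_image_cancel) (auto simp: vertex_pairs_def)
  have E': "(`) ?g ` (`) f ` E = E"
    using gf by (auto simp: image_iff) 
  have iff: "(f x, f y) \<in> connection_rel (f ` V, (`) f ` E) \<longleftrightarrow> (x, y) \<in> connection_rel (V, E)"
    if "x \<in> V" "y \<in> V" for x y
    using that rtrancl_adjacent_image[of x y E f]
      rtrancl_adjacent_image[of "f x" "f y" "(`) f ` E" ?g] E' inj
    by (auto simp: connection_rel_def)
  have cls: "connection_rel (f ` V, (`) f ` E) `` {f x} = f ` (connection_rel (V, E) `` {x})"
    if "x \<in> V" for x
  proof -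
    have "connection_rel (f ` V, (`) f ` E) `` {f x} \<subseteq> f ` V"
         "connection_rel (V, E) `` {x} \<subseteq> V"
      by (auto simp: connection_rel_def)
    then show ?thesis using iff[OF that] by (auto simp: subset_iff image_iff) blast
  qed
  have "connected_components (f ` V, (`) f ` E) = (`) f ` connected_components (V, E)"
    using cls by (auto simp: connected_components_def quotient_def)
  moreover have "inj_on ((`) f) (connected_components (V, E))"
    by (rule inj_on_subset[OF inj_on_image_Pow[OF inj]])
       (use Union_connected_components[of V E] in blast)
  ultimately show ?thesis by (simp add: pi0_def card_image)
qed

section \<open>Weighted sums over graphs\<close>

lemma sum_power_card_Pow:
  fixes \<rho> :: real
  assumes "finite A"
  shows "(\<Sum>E\<in>Pow A. \<rho> ^ card E) = (\<rho> + 1) ^ card A"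
  using prod_add[OF assms, of "\<lambda>_. \<rho>" "\<lambda>_. 1"] by simp

text \<open>A subset of \<open>A \<union> B\<close> splits uniquely into its two parts and the
  weight is multiplicative. As \<open>h\<close> sees only the part in \<open>A\<close>, the part in
  \<open>B\<close> contributes its total weight.\<close>

lemma sum_Pow_Un:
  fixes \<rho> :: real
  assumes fin: "finite A" "finite B" and disj: "A \<inter> B = {}"
  shows "(\<Sum>E\<in>Pow (A \<union> B). \<rho> ^ card E * h (E \<inter> A)) = (\<Sum>E\<in>Pow A. \<rho> ^ card E * h E) * (\<rho> + 1) ^ card B"
proof -
  have "(\<Sum>E\<in>Pow A. \<rho> ^ card E * h E) * (\<Sum>F\<in>Pow B. \<rho> ^ card F) =
      (\<Sum>(E, F)\<in>Pow A \<times> Pow B. (\<rho> ^ card E * h E) * \<rho> ^ card F)"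
    by (simp add: sum_product sum.cartesian_product)
  also have "\<dots> = (\<Sum>E\<in>Pow (A \<union> B). \<rho> ^ card E * h (E \<inter> A))"
  proof (rule sum.reindex_bij_witness[where i = "\<lambda>E. (E \<inter> A, E \<inter> B)" and j = "\<lambda>(E, F). E \<union> F"])
    fix x assume "x \<in> Pow A \<times> Pow B"
    then obtain E F where x: "x = (E, F)" "E \<subseteq> A" "F \<subseteq> B" by auto
    then have "card (E \<union> F) = card E + card F"
      using fin disj by (intro card_Un_disjoint) (auto intro: finite_subset)
    moreover have "(E \<union> F) \<inter> A = E" using x disj by auto
    ultimately show "\<rho> ^ card (case x of (E, F) \<Rightarrow> E \<union> F) * h ((case x of (E, F) \<Rightarrow> E \<union> F) \<inter> A) =
        (case x of (E, F) \<Rightarrow> \<rho> ^ card E * h E * \<rho> ^ card F)"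
      using x by (simp add: power_add)
  qed (use disj in auto)
  finally show ?thesis using sum_power_card_Pow[OF fin(2)] by metis
qed

text \<open>Once \<open>S\<close> is separated, the pairs inside \<open>V - S\<close> are free and
  contribute \<open>\<rho> + 1\<close> each, while pairs between \<open>S\<close> and
  \<open>V - S\<close> must be absent.\<close>

lemma sum_separated:
  fixes \<rho> :: real
  assumes "finite V" "S \<subseteq> V"
  shows "(\<Sum>E\<in>{E \<in> Pow (vertex_pairs V). separated V E S}. \<rho> ^ card E * h (E \<inter> vertex_pairs S)) =
    (\<Sum>E\<in>Pow (vertex_pairs S). \<rho> ^ card E * h E) * (\<rho> + 1) ^ ((card V - card S) choose 2)"
proof -
  have fS: "finite S" using assms by (rule finite_subset[rotated])
  have "{E \<in> Pow (vertex_pairs V). separated V E S} = Pow (vertex_pairs S \<union> vertex_pairs (V - S))"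
    using assms vertex_pairs_mono[of S V] vertex_pairs_mono[of "V - S" V]
    by (auto simp: separated_def)
  moreover have "card (V - S) = card V - card S"
    using assms fS by (simp add: card_Diff_subset)
  ultimately show ?thesis
    using assms fS by (simp add: sum_Pow_Un vertex_pairs_disjoint card_vertex_pairs)
qed

lemma vertex_pairs_image:
  assumes "inj_on f V"
  shows "(`) f ` vertex_pairs V = vertex_pairs (f ` V)"
proof (intro equalityI subsetI)
  fix e assume "e \<in> (`) f ` vertex_pairs V"
  then show "e \<in> vertex_pairs (f ` V)"
    using assms by (auto simp: vertex_pairs_def card_image inj_on_subset)
next
  fix e assume "e \<in> vertex_pairs (f ` V)"
  then obtain d where d: "d \<subseteq> V" "e = f ` d" "card e = 2"
    by (auto simp: vertex_pairs_def subset_image_iff)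
  then have "card d = 2" using assms by (simp add: card_image inj_on_subset)
  then show "e \<in> (`) f ` vertex_pairs V" using d by (auto simp: vertex_pairs_def)
qed

lemma sum_labeled_graphs:
  "(\<Sum>g\<in>labeled_graphs k. h g) = (\<Sum>E\<in>Pow (vertex_pairs {1..k}). h ({1..k}, E))"
proof -
  have "labeled_graphs k = Pair {1..k} ` Pow (vertex_pairs {1..k})"
    by (auto simp: labeled_graphs_def)
  then show ?thesis by (simp add: sum.reindex inj_on_def)
qed

lemma sum_edge_sets_eq_labeled_graphs:
  assumes "finite S"
  shows "(\<Sum>E\<in>Pow (vertex_pairs S). \<rho> ^ card E * h (pi0 (S, E))) =
    (\<Sum>g\<in>labeled_graphs (card S). weight \<rho> g * h (pi0 g))"
proof -
  let ?V = "{1..card S}"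
  obtain f where f: "bij_betw f ?V S"
    using ex_bij_betw_nat_finite_1[OF assms] by blast
  then have inj: "inj_on f ?V" and S: "S = f ` ?V" by (auto simp: bij_betw_def)
  have "inj_on ((`) f) (vertex_pairs ?V)"
    by (rule inj_on_subset[OF inj_on_image_Pow[OF inj]]) (auto simp: vertex_pairs_def)
  then have bij: "bij_betw ((`) f) (vertex_pairs ?V) (vertex_pairs S)"
    using vertex_pairs_image[OF inj] S by (simp add: bij_betw_def)
  have "(\<Sum>E\<in>Pow (vertex_pairs S). \<rho> ^ card E * h (pi0 (S, E))) =
      (\<Sum>E\<in>Pow (vertex_pairs ?V). \<rho> ^ card ((`) f ` E) * h (pi0 (S, (`) f ` E)))"
    by (rule sum.reindex_bij_betw[OF bij_betw_Pow[OF bij], symmetric])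
  also have "\<dots> = (\<Sum>E\<in>Pow (vertex_pairs ?V). \<rho> ^ card E * h (pi0 (?V, E)))"
  proof (rule sum.cong[OF refl])
    fix E assume E: "E \<in> Pow (vertex_pairs ?V)"
    then have "card ((`) f ` E) = card E"
      using bij by (intro card_image) (auto simp: bij_betw_def inj_on_subset)
    moreover have "pi0 (S, (`) f ` E) = pi0 (?V, E)"
      using pi0_image[OF inj, of E] E S by auto
    ultimately show "\<rho> ^ card ((`) f ` E) * h (pi0 (S, (`) f ` E)) = \<rho> ^ card E * h (pi0 (?V, E))"
      by simp
  qed
  finally show ?thesis by (simp add: sum_labeled_graphs weight_def)
qed

text \<open>The number of pairs that meet a fixed \<open>k\<close>-set is
  \<open>n * k - k * (k + 1) div 2\<close>; this is the source of the exponent in the scale. The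
  additive form avoids truncated subtraction.\<close>

lemma choose_two_diff:
  assumes "k \<le> n"
  shows "(n choose 2) + k * (k + 1) div 2 = n * k + ((n - k) choose 2)"
proof -
  obtain d where n: "n = k + d" using assms le_Suc_ex by blast
  have even: "even (a * (a - 1))" for a :: nat by (cases a) auto
  have "2 * (n choose 2) = n * (n - 1)" "2 * ((n - k) choose 2) = (n - k) * (n - k - 1)"
       "2 * (k * (k + 1) div 2) = k * (k + 1)"
    using dvd_mult_div_cancel[OF even[of n]] dvd_mult_div_cancel[OF even[of "n - k"]]
    by (simp_all add: choose_two)
  moreover have "n * (n - 1) + k * (k + 1) = 2 * (n * k) + (n - k) * (n - k - 1)"
    unfolding n by (cases d; cases k) (simp_all add: algebra_simps)
  ultimately show ?thesis by linarith
qed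

lemma sum_subsets_by_card:
  fixes F :: "nat \<Rightarrow> real"
  assumes "finite V" "finite K"
  shows "(\<Sum>S\<in>{S \<in> Pow V. card S \<in> K}. F (card S)) = (\<Sum>k\<in>K. real (card V choose k) * F k)"
proof -
  have "(\<Sum>S\<in>{S \<in> Pow V. card S \<in> K}. F (card S)) =
      (\<Sum>k\<in>K. \<Sum>S\<in>{S \<in> {S \<in> Pow V. card S \<in> K}. card S = k}. F (card S))"
    by (rule sum.group[symmetric]) (use assms in auto)
  also have "\<dots> = (\<Sum>k\<in>K. real (card V choose k) * F k)"
  proof (rule sum.cong[OF refl])
    fix k assume "k \<in> K"
    then have "{S \<in> {S \<in> Pow V. card S \<in> K}. card S = k} = {S. S \<subseteq> V \<and> card S = k}" by auto
    then show "(\<Sum>S\<in>{S \<in> {S \<in> Pow V. card S \<in> K}. card S = k}. F (card S)) = real (card V choose k) * F k"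
      using assms by (simp add: n_subsets)
  qed
  finally show ?thesis .
qed

text \<open>Since \<open>q ^ (n choose 2) * \<rho> ^ card E\<close> is the probability of
  \<open>E\<close>, the left side is an expectation; exchanging the sums over \<open>E\<close> and
  \<open>S\<close> computes it. The lemma serves twice: with the signed binomials and small
  \<open>K\<close> it gives the truncated expansion, with \<open>h = 1\<close> the expected number
  of separated sets of medium size.\<close>

lemma sum_over_separated_sets:
  fixes \<rho> q :: real
  assumes q: "q \<noteq> 0" "\<rho> + 1 = 1 / q" and K: "finite K"
  shows "q ^ (n choose 2) * (\<Sum>E\<in>Pow (vertex_pairs {1..n}). \<rho> ^ card E *
      (\<Sum>S\<in>{S. separated {1..n} E S \<and> card S \<in> K}. h (pi0 (S, E \<inter> vertex_pairs S)))) =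
    (\<Sum>k\<in>K. (\<Sum>g\<in>labeled_graphs k. weight \<rho> g * h (pi0 g)) *
      (real (n choose k) * (q ^ (n * k) / q ^ (k * (k + 1) div 2))))"
    (is "?l = (\<Sum>k\<in>K. ?w k * (_ * ?g k))")
proof -
  let ?V = "{1..n}" and ?A = "{S \<in> Pow {1..n}. card S \<in> K}"
  have "(\<Sum>E\<in>Pow (vertex_pairs ?V). \<rho> ^ card E *
      (\<Sum>S\<in>{S. separated ?V E S \<and> card S \<in> K}. h (pi0 (S, E \<inter> vertex_pairs S)))) =
    (\<Sum>E\<in>Pow (vertex_pairs ?V). \<Sum>S\<in>{S \<in> ?A. separated ?V E S}.
       \<rho> ^ card E * h (pi0 (S, E \<inter> vertex_pairs S)))"
    unfolding sum_distrib_left by (intro sum.cong refl) (auto simp: separated_def)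
  also have "\<dots> = (\<Sum>S\<in>?A. \<Sum>E\<in>{E \<in> Pow (vertex_pairs ?V). separated ?V E S}.
       \<rho> ^ card E * h (pi0 (S, E \<inter> vertex_pairs S)))"
    by (rule sum.swap_restrict) auto
  also have "\<dots> = (\<Sum>S\<in>?A. ?w (card S) * (\<rho> + 1) ^ ((n - card S) choose 2))"
  proof (rule sum.cong[OF refl])
    fix S assume "S \<in> ?A"
    then have S: "S \<subseteq> ?V" "finite S" by (auto intro: finite_subset)
    show "(\<Sum>E\<in>{E \<in> Pow (vertex_pairs ?V). separated ?V E S}.
       \<rho> ^ card E * h (pi0 (S, E \<inter> vertex_pairs S))) = ?w (card S) * (\<rho> + 1) ^ ((n - card S) choose 2)"
      using sum_separated[of ?V S \<rho> "\<lambda>E. h (pi0 (S, E))"] S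
      by (simp add: sum_edge_sets_eq_labeled_graphs)
  qed
  also have "\<dots> = (\<Sum>k\<in>K. real (n choose k) * (?w k * (\<rho> + 1) ^ ((n - k) choose 2)))"
    using sum_subsets_by_card[OF _ K, of ?V "\<lambda>k. ?w k * (\<rho> + 1) ^ ((n - k) choose 2)"] by simp
  finally have "?l = (\<Sum>k\<in>K. q ^ (n choose 2) * (real (n choose k) * (?w k * (\<rho> + 1) ^ ((n - k) choose 2))))"
    by (simp add: sum_distrib_left)
  also have "\<dots> = (\<Sum>k\<in>K. ?w k * (real (n choose k) * ?g k))"
  proof (rule sum.cong[OF refl])
    fix k
    show "q ^ (n choose 2) * (real (n choose k) * (?w k * (\<rho> + 1) ^ ((n - k) choose 2))) =
        ?w k * (real (n choose k) * ?g k)"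
    proof (cases "k \<le> n")
      case True
      have "q ^ (n choose 2) * q ^ (k * (k + 1) div 2) = q ^ (n * k) * q ^ ((n - k) choose 2)"
        using choose_two_diff[OF True] by (simp only: flip: power_add)
      then have "q ^ (n choose 2) / q ^ ((n - k) choose 2) = ?g k"
        by (subst frac_eq_eq) (use q in auto)
      moreover have "(\<rho> + 1) ^ ((n - k) choose 2) = 1 / q ^ ((n - k) choose 2)"
        by (simp only: q(2) power_one_over)
      ultimately have eq: "q ^ (n choose 2) * (\<rho> + 1) ^ ((n - k) choose 2) = ?g k"
        by (simp only: times_divide_eq_right mult_1_right)
      show ?thesis unfolding eq[symmetric] by (simp only: mult_ac)
    \<comment> \<open>For \<open>k > n\<close> the exponents no longer match, but both sides vanish
      through \<open>n choose k\<close>.\<close>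
    next
      case False
      then show ?thesis by (simp add: binomial_eq_0)
    qed
  qed
  finally show ?thesis .
qed

section \<open>Probabilities in the random graph as weighted sums\<close>

lemma prob_erdos_renyi:
  assumes p: "0 < p" "p < 1" and q: "q = 1 - p" and \<rho>: "\<rho> = p / q"
  shows "measure_pmf.prob (erdos_renyi n p) {g. P g} = q ^ (n choose 2) *
    (\<Sum>E\<in>Pow (vertex_pairs {1..n}). \<rho> ^ card E * of_bool (P ({1..n}, E)))"
proof -
  let ?A = "vertex_pairs {1..n}"
  let ?M = "map_pmf (\<lambda>X. {e \<in> ?A. X e}) (Pi_pmf ?A False (\<lambda>_. bernoulli_pmf p))"
  let ?Q = "{E. P ({1..n}, E)}"
  have pmf: "pmf ?M E = q ^ (n choose 2) * \<rho> ^ card E" if E: "E \<in> Pow ?A" for E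
  proof -
    have fE: "finite E" by (rule finite_subset[of _ ?A]) (use E in auto)
    \<comment> \<open>The preimage of a single edge set is a box, so its measure is a product over
      all pairs.\<close>
    have "(\<lambda>X. {e \<in> ?A. X e}) -` {E} = Pi ?A (\<lambda>e. {e \<in> E})"
      using E by (auto simp: Pi_def)
    then have "pmf ?M E = (\<Prod>e\<in>?A. pmf (bernoulli_pmf p) (e \<in> E))"
      by (simp add: pmf_map measure_Pi_pmf_Pi measure_pmf_single)
    also have "\<dots> = (\<Prod>e\<in>?A. if e \<in> E then p else q)"
      using p q by (intro prod.cong refl) simp
    also have "\<dots> = p ^ card E * q ^ card (?A - E)"
      using E by (simp add: prod.If_cases Int_absorb1 Diff_eq)
    also have "card (?A - E) = (n choose 2) - card E"
      using E fE by (simp add: card_Diff_subset card_vertex_pairs)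
    also have "p ^ card E * q ^ ((n choose 2) - card E) = q ^ (n choose 2) * \<rho> ^ card E"
    proof -
      have "card E \<le> n choose 2"
        using E card_mono[of ?A E] by (simp add: card_vertex_pairs)
      then show ?thesis using p q \<rho> by (simp add: power_divide power_diff)
    qed
    finally show ?thesis .
  qed
  have "measure_pmf.prob (erdos_renyi n p) {g. P g} = measure_pmf.prob ?M ?Q"
    by (simp add: erdos_renyi_def vimage_def)
  \<comment> \<open>The support lies in \<open>Pow ?A\<close>, which makes the event finite.\<close>
  also have "\<dots> = measure_pmf.prob ?M (?Q \<inter> Pow ?A)"
    by (rule measure_prob_cong_0) (auto simp: pmf_eq_0_set_pmf)
  also have "\<dots> = (\<Sum>E\<in>Pow ?A \<inter> ?Q. pmf ?M E)"
    by (subst measure_measure_pmf_finite) (auto simp: Int_commute)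
  also have "\<dots> = (\<Sum>E\<in>Pow ?A. if E \<in> ?Q then pmf ?M E else 0)"
    by (rule sum.inter_restrict) simp
  also have "\<dots> = (\<Sum>E\<in>Pow ?A. q ^ (n choose 2) * (\<rho> ^ card E * of_bool (P ({1..n}, E))))"
    by (intro sum.cong refl) (use pmf in auto)
  finally show ?thesis by (simp only: sum_distrib_left)
qed

section \<open>The truncated sum on a single graph\<close>

text \<open>Rewriting \<open>(N choose j) * (j choose i)\<close> as
  \<open>(N choose i) * ((N - i) choose (j - i))\<close> leaves the alternating sum of row
  \<open>N - i\<close>, which vanishes unless \<open>N = i\<close>.\<close>

lemma sum_binomial_inversion:
  "(\<Sum>j\<le>N. real (N choose j) * ((-1) ^ (i + j) * real (j choose i))) = of_bool (N = i)"
proof (cases "i \<le> N")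
  case True
  have "(\<Sum>j\<le>N. real (N choose j) * ((-1) ^ (i + j) * real (j choose i))) =
      (\<Sum>j\<in>{i..N}. real (N choose j) * ((-1) ^ (i + j) * real (j choose i)))"
    by (rule sum.mono_neutral_right) auto
  also have "\<dots> = (\<Sum>j\<in>{i..N}. real (N choose i) * ((-1) ^ (j - i) * real ((N - i) choose (j - i))))"
  proof (rule sum.cong[OF refl])
    fix j assume j: "j \<in> {i..N}"
    then have "(N choose j) * (j choose i) = (N choose i) * ((N - i) choose (j - i))"
      by (intro choose_mult) auto
    then have "real (N choose j) * real (j choose i) = real (N choose i) * real ((N - i) choose (j - i))"
      by (metis of_nat_mult)
    moreover have "(-1 :: real) ^ (i + j) = (-1) ^ (j - i)"
    proof -
      have "i + j = 2 * i + (j - i)" using j by auto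
      then show ?thesis by (metis mult_1 power_add power_minus1_even)
    qed
    ultimately show "real (N choose j) * ((-1) ^ (i + j) * real (j choose i)) =
        real (N choose i) * ((-1) ^ (j - i) * real ((N - i) choose (j - i)))"
      by (simp add: algebra_simps)
  qed
  also have "\<dots> = (\<Sum>l\<le>N - i. real (N choose i) * ((-1) ^ l * real ((N - i) choose l)))"
    by (rule sum.reindex_bij_witness[where i = "\<lambda>l. l + i" and j = "\<lambda>j. j - i"]) (use True in auto)
  also have "\<dots> = of_bool (N = i)"
    using choose_alternating_sum[of "N - i", where 'a = real] True
    by (cases "N = i") (auto simp flip: sum_distrib_left)
  finally show ?thesis .
next
  case False
  then show ?thesis by (auto intro!: sum.neutral)
qed

text \<open>This is the unweighted summand of \<open>P_coeff\<close> as a function of the number of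
  components alone.\<close>

definition signed_binomial :: "nat \<Rightarrow> nat \<Rightarrow> real" where
  "signed_binomial m j = (-1) powi (int j - (int m - 1)) * real (j choose (m - 1))"

text \<open>The two exponents differ by the even number \<open>2 * (m - 1)\<close>, so the integer
  power becomes a natural one, as inversion requires.\<close>

lemma signed_binomial_eq:
  assumes "m \<ge> 1"
  shows "signed_binomial m j = (-1) ^ (m - 1 + j) * real (j choose (m - 1))"
proof -
  have "int j - (int m - 1) = int (m - 1 + j) - 2 * int (m - 1)" using assms by simp
  then have "(-1 :: real) powi (int j - (int m - 1)) = (-1) powi int (m - 1 + j) / (-1) powi (2 * int (m - 1))"
    by (metis power_int_diff zero_neq_neg_one)
  then show ?thesis by (simp add: signed_binomial_def power_int_mult del: of_nat_add)
qed

lemma abs_signed_binomial_le: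
  assumes "m \<ge> 1"
  shows "\<bar>signed_binomial m j\<bar> \<le> 2 ^ j"
  using binomial_le_pow2[of j "m - 1"]
  by (simp add: signed_binomial_eq[OF assms] abs_mult flip: of_nat_power numeral_power_eq_of_nat_cancel_iff)

lemma P_coeff_eq: "P_coeff k m \<rho> = (\<Sum>g\<in>labeled_graphs k. weight \<rho> g * signed_binomial m (pi0 g))"
  by (simp add: P_coeff_def signed_binomial_def mult_ac)

text \<open>Inversion at \<open>i = m - 1\<close>. Below, \<open>X\<close> consists of all
  components except the giant one, which explains the shift from \<open>m\<close> to
  \<open>m - 1\<close> in the coefficients.\<close>

lemma sum_signed_binomial_subsets:
  assumes "m \<ge> 1" "finite X"
  shows "(\<Sum>A\<in>Pow X. signed_binomial m (card A)) = of_bool (card X + 1 = m)"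
proof -
  have "Pow X = {A \<in> Pow X. card A \<in> {..card X}}"
    using assms by (auto intro: card_mono)
  then have "(\<Sum>A\<in>Pow X. signed_binomial m (card A)) =
      (\<Sum>j\<le>card X. real (card X choose j) * signed_binomial m j)"
    using sum_subsets_by_card[OF assms(2), of "{..card X}" "signed_binomial m"] by simp
  then show ?thesis
    using sum_binomial_inversion[of "card X" "m - 1"] assms
    by (auto simp: signed_binomial_eq)
qed

lemma sum_signed_binomial_giant:
  assumes m: "m \<ge> 1" and V: "finite V" and E: "E \<subseteq> vertex_pairs V"
    and C: "C \<in> connected_components (V, E)" "card (V - C) \<le> r" "r < card C"
  shows "(\<Sum>S\<in>{S. separated V E S \<and> card S \<le> r}. signed_binomial m (pi0 (S, E \<inter> vertex_pairs S)))
    = of_bool (pi0 (V, E) = m)"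
proof -
  let ?CC = "connected_components (V, E)"
  have CC: "D \<subseteq> V" if "D \<in> ?CC" for D
    using that Union_connected_components[of V E] by blast
  \<comment> \<open>A union that avoids \<open>C\<close> lies in \<open>V - C\<close>, which has at
    most \<open>r\<close> vertices; one that contains \<open>C\<close> has more than
    \<open>r\<close>.\<close>
  have iff: "card (\<Union> A) \<le> r \<longleftrightarrow> C \<notin> A" if A: "A \<subseteq> ?CC" for A
  proof
    assume "C \<notin> A"
    then have "D \<inter> C = {}" if "D \<in> A" for D
      using connected_components_disjoint[of D V E C] that A C(1) by blast
    then have "\<Union> A \<subseteq> V - C" using A CC by blast
    then have "card (\<Union> A) \<le> card (V - C)" using V by (intro card_mono) auto
    then show "card (\<Union> A) \<le> r" using C by simp
  next
    assume "card (\<Union> A) \<le> r"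
    moreover have "finite (\<Union> A)"
      by (rule finite_subset[of _ V]) (use A CC V in auto)
    then have "card C \<le> card (\<Union> A)" if "C \<in> A"
      using that by (intro card_mono) auto
    ultimately show "C \<notin> A" using C(3) by linarith
  qed
  have "Union ` {A \<in> Pow ?CC. card (\<Union> A) \<le> r} = {S \<in> Union ` Pow ?CC. card S \<le> r}"
    by blast
  then have "bij_betw Union {A \<in> Pow ?CC. card (\<Union> A) \<le> r} {S. separated V E S \<and> card S \<le> r}"
    using bij_betw_Union_separated[OF E] unfolding bij_betw_def
    by (intro conjI) (auto intro: inj_on_subset)
  moreover have "{A \<in> Pow ?CC. card (\<Union> A) \<le> r} = Pow (?CC - {C})"
    using iff by auto
  ultimately have "bij_betw Union (Pow (?CC - {C})) {S. separated V E S \<and> card S \<le> r}" by simp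
  then have "(\<Sum>S\<in>{S. separated V E S \<and> card S \<le> r}. signed_binomial m (pi0 (S, E \<inter> vertex_pairs S)))
     = (\<Sum>A\<in>Pow (?CC - {C}). signed_binomial m (pi0 (\<Union> A, E \<inter> vertex_pairs (\<Union> A))))"
    by (rule sum.reindex_bij_betw[symmetric])
  also have "\<dots> = (\<Sum>A\<in>Pow (?CC - {C}). signed_binomial m (card A))"
    by (intro sum.cong refl) (subst pi0_Union[OF E], auto)
  also have "\<dots> = of_bool (card (?CC - {C}) + 1 = m)"
    using V by (intro sum_signed_binomial_subsets m) simp
  also have "card (?CC - {C}) + 1 = pi0 (V, E)"
    using card_Suc_Diff1[OF finite_connected_components[OF V] C(1)] by (simp add: pi0_def)
  finally show ?thesis .
qed

text \<open>Take a union of components with more than \<open>r\<close> vertices, of minimal size \<open>t\<close>.  By minimality each of its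
  components has at least \<open>t - r\<close> vertices, so either it is a single component, or \<open>t \<le> 2 r\<close>.\<close>

lemma exists_medium_separated_set:
  assumes V: "finite V" and E: "E \<subseteq> vertex_pairs V" and r: "4 * r \<le> card V" "r < card V"
    and no_giant: "\<And>C. C \<in> connected_components (V, E) \<Longrightarrow> r < card (V - C)"
  obtains T where "separated V E T" "r < card T" "2 * card T \<le> card V"
proof -
  let ?CC = "connected_components (V, E)"
  have CC: "D \<subseteq> V" if "D \<in> ?CC" for D
    using that Union_connected_components[of V E] by blast
  have "\<exists>A. (A \<subseteq> ?CC \<and> r < card (\<Union> A)) \<and>
      (\<forall>B. B \<subseteq> ?CC \<and> r < card (\<Union> B) \<longrightarrow> card (\<Union> A) \<le> card (\<Union> B))"
    by (rule ex_has_least_nat[of _ ?CC]) (use r in simp)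
  then obtain A where A: "A \<subseteq> ?CC" "r < card (\<Union> A)"
    and min: "\<And>B. B \<subseteq> ?CC \<Longrightarrow> r < card (\<Union> B) \<Longrightarrow> card (\<Union> A) \<le> card (\<Union> B)"
    by metis
  have AV: "\<Union> A \<subseteq> V" using A CC by blast
  then have finA: "finite (\<Union> A)" using V by (rule finite_subset)
  have large: "card (\<Union> A) \<le> card C + r" if C: "C \<in> A" for C
  proof -
    have disj: "D \<inter> C = {}" if "D \<in> A - {C}" for D
      using connected_components_disjoint[of D V E C] that A C by blast
    have sub: "\<Union> (A - {C}) = \<Union> A - C" using disj C by blast
    have "C \<noteq> {}" "C \<subseteq> \<Union> A" using C A empty_notin_connected_components by blast+
    then have "card (\<Union> A - C) < card (\<Union> A)" using finA by (intro psubset_card_mono) auto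
    then have "\<not> r < card (\<Union> A - C)"
      using min[of "A - {C}"] A sub by auto
    moreover have "card (\<Union> A - C) = card (\<Union> A) - card C"
      using \<open>C \<subseteq> \<Union> A\<close> finA by (intro card_Diff_subset) (auto intro: finite_subset)
    ultimately show ?thesis by linarith
  qed
  have sep: "separated V E (\<Union> A)" by (rule separated_Union[OF E A(1)])
  show thesis
  proof (cases "2 * card (\<Union> A) \<le> card V")
    case True
    then show ?thesis using that[OF sep A(2)] by simp
  next
    case False
    have "A \<noteq> {}" using A by auto
    then obtain C where C: "C \<in> A" by blast
    \<comment> \<open>Two distinct components would give \<open>2 * (t - r) \<le> t\<close>, so
      \<open>t \<le> 2 * r\<close> and \<open>2 * t \<le> 4 * r \<le> card V\<close>, contrary to
      the case assumption. This is where the factor 4 comes from.\<close>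
    have "A = {C}"
    proof (rule ccontr)
      assume "A \<noteq> {C}"
      then obtain D where D: "D \<in> A" "D \<noteq> C" using C by blast
      then have "C \<inter> D = {}" using connected_components_disjoint[of C V E D] A C by blast
      moreover have "finite C" "finite D"
        by (rule finite_subset[OF _ finA]; use C D in blast)+
      ultimately have "card C + card D = card (C \<union> D)" by (simp add: card_Un_disjoint)
      also have "\<dots> \<le> card (\<Union> A)" using C D finA by (intro card_mono) auto
      finally show False using large[OF C] large[OF D(1)] False r by linarith
    qed
    then have eq: "\<Union> A = C" by simp
    have "card (V - C) = card V - card C"
      using AV finA eq by (intro card_Diff_subset) auto
    \<comment> \<open>The single component \<open>C\<close> fills more than half of
      \<open>V\<close>; its complement is the required set, with more than \<open>r\<close> vertices
      by \<open>no_giant\<close>.\<close>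
    then show ?thesis
      using that[of "V - C"] separated_compl[OF sep] no_giant[of C] False A C eq by auto
  qed
qed

text \<open>With a giant component the error is zero. Otherwise at least one medium separated set
  exists, so the crude bound \<open>?B\<close> (1 for the indicator, \<open>2 ^ r\<close> for each
  small set) may be multiplied by their number. That number is written as a sum of ones to fit
  \<open>sum_over_separated_sets\<close>.\<close>

lemma abs_truncation_error_le:
  assumes m: "m \<ge> 1" and V: "finite V" and E: "E \<subseteq> vertex_pairs V" and r: "4 * r < card V"
  shows "\<bar>of_bool (pi0 (V, E) = m) -
      (\<Sum>S\<in>{S. separated V E S \<and> card S \<le> r}. signed_binomial m (pi0 (S, E \<inter> vertex_pairs S)))\<bar>
    \<le> (1 + 2 ^ r * (\<Sum>k\<le>r. real (card V choose k))) *
      (\<Sum>S\<in>{S. separated V E S \<and> card S \<in> {r + 1..card V div 2}}. 1)"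
    (is "?err \<le> ?B * ?N")
proof (cases "\<exists>C\<in>connected_components (V, E). card (V - C) \<le> r")
  case True
  then obtain C where C: "C \<in> connected_components (V, E)" "card (V - C) \<le> r" by blast
  have "C \<subseteq> V" using C Union_connected_components[of V E] by blast
  then have "card (V - C) = card V - card C"
    using V by (intro card_Diff_subset) (auto intro: finite_subset)
  then have "?err = 0"
    using sum_signed_binomial_giant[OF m V E C] C r by simp
  moreover have "0 \<le> ?B * ?N"
    by (intro mult_nonneg_nonneg add_nonneg_nonneg sum_nonneg) auto
  ultimately show ?thesis by simp
next
  case False
  have fin: "finite {S. separated V E S \<and> P S}" for P
    by (rule finite_subset[of _ "Pow V"]) (use V in \<open>auto simp: separated_def\<close>)
  obtain T where T: "separated V E T" "r < card T" "2 * card T \<le> card V"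
    by (rule exists_medium_separated_set[OF V E, of r]) (use False r in \<open>auto simp: not_le\<close>)
  then have "T \<in> {S. separated V E S \<and> card S \<in> {r + 1..card V div 2}}" by auto
  then have "{S. separated V E S \<and> card S \<in> {r + 1..card V div 2}} \<noteq> {}" by blast
  then have "card {S. separated V E S \<and> card S \<in> {r + 1..card V div 2}} > 0"
    using fin by (simp add: card_gt_0_iff del: atLeastAtMost_iff)
  then have N: "1 \<le> ?N" by simp
  have "\<bar>\<Sum>S\<in>{S. separated V E S \<and> card S \<le> r}. signed_binomial m (pi0 (S, E \<inter> vertex_pairs S))\<bar>
     \<le> (\<Sum>S\<in>{S. separated V E S \<and> card S \<le> r}. 2 ^ r)"
  proof (rule order_trans[OF sum_abs sum_mono])
    fix S assume "S \<in> {S. separated V E S \<and> card S \<le> r}"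
    then have "finite S" "card S \<le> r" using V by (auto simp: separated_def intro: finite_subset)
    then have "pi0 (S, E \<inter> vertex_pairs S) \<le> r" using pi0_le_card order_trans by blast
    then have "(2 :: real) ^ pi0 (S, E \<inter> vertex_pairs S) \<le> 2 ^ r" by (intro power_increasing) auto
    then show "\<bar>signed_binomial m (pi0 (S, E \<inter> vertex_pairs S))\<bar> \<le> 2 ^ r"
      using abs_signed_binomial_le[OF m] order_trans by blast
  qed
  also have "\<dots> \<le> (\<Sum>S\<in>{S \<in> Pow V. card S \<in> {..r}}. 2 ^ r)"
    using V by (intro sum_mono2) (auto simp: separated_def)
  also have "\<dots> = 2 ^ r * (\<Sum>k\<le>r. real (card V choose k))"
    using sum_subsets_by_card[OF V, of "{..r}" "\<lambda>_. 2 ^ r"] by (simp add: sum_distrib_left mult.commute)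
  finally have "?err \<le> ?B" by (auto simp: of_bool_def)
  also have "\<dots> \<le> ?B * ?N"
    using mult_left_mono[OF N, of ?B] by (simp add: sum_nonneg)
  finally show ?thesis .
qed

section \<open>Asymptotics\<close>

text \<open>With \<open>s = root M q\<close> the term is the \<open>M\<close>-th power of
  \<open>n * s ^ n\<close>, which tends to 0.\<close>

lemma tendsto_power_times_geometric:
  fixes q :: real
  assumes q: "0 < q" "q < 1" and M: "M > 0"
  shows "(\<lambda>n. real n ^ M * q ^ n) \<longlonglongrightarrow> 0"
proof -
  let ?s = "root M q"
  have "norm ?s < 1" using q M by simp
  then have "(\<lambda>n. (real n * ?s ^ n) ^ M) \<longlonglongrightarrow> 0 ^ M"
    by (intro tendsto_power powser_times_n_limit_0)
  moreover have "(real n * ?s ^ n) ^ M = real n ^ M * q ^ n" for n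
  proof -
    have "(?s ^ n) ^ M = (?s ^ M) ^ n" by (simp only: mult.commute flip: power_mult)
    then show ?thesis using q M by (simp add: power_mult_distrib)
  qed
  ultimately show ?thesis using M by (simp add: zero_power)
qed

lemma eventually_power_times_geometric_le_1:
  fixes q :: real
  assumes "0 < q" "q < 1" "M > 0"
  shows "eventually (\<lambda>n. real n ^ M * q ^ n \<le> 1) sequentially"
  using order_tendstoD(2)[OF tendsto_power_times_geometric[OF assms], of 1]
  by (auto elim: eventually_mono)

definition expansion_scale :: "real \<Rightarrow> nat \<Rightarrow> nat \<Rightarrow> real" where
  "expansion_scale q k n = real (n choose k) * (q ^ (n * k) / q ^ (k * (k + 1) div 2))"

text \<open>The quotient of consecutive scales is at most a constant times \<open>n * q ^ n\<close>,
  because \<open>n choose Suc k\<close> is at most \<open>n * (n choose k)\<close>.\<close>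

lemma expansion_scale_Suc_smallo:
  fixes q :: real
  assumes q: "0 < q" "q < 1"
  shows "expansion_scale q (Suc k) \<in> o(expansion_scale q k)"
proof -
  let ?c = "\<lambda>j. q ^ (j * (j + 1) div 2)"
  have "expansion_scale q (Suc k) \<in> O(\<lambda>n. (real n ^ 1 * q ^ n) * expansion_scale q k n)"
  proof (rule bigoI[where c = "?c k / ?c (Suc k)"], rule always_eventually, rule allI)
    fix n
    have "n choose Suc k \<le> Suc k * (n choose Suc k)" by simp
    also have "\<dots> = (n - k) * (n choose k)" by (simp only: binomial_absorption binomial_absorb_comp)
    also have "\<dots> \<le> n * (n choose k)" by simp
    finally have "real (n choose Suc k) \<le> real n * real (n choose k)"
      by (metis of_nat_le_iff of_nat_mult)
    then have "expansion_scale q (Suc k) n \<le> (real n * real (n choose k)) * (q ^ (n * Suc k) / ?c (Suc k))"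
      using q unfolding expansion_scale_def by (intro mult_right_mono) auto
    also have "\<dots> = ?c k / ?c (Suc k) * ((real n ^ 1 * q ^ n) * expansion_scale q k n)"
      using q by (simp add: expansion_scale_def power_add)
    finally show "norm (expansion_scale q (Suc k) n) \<le> ?c k / ?c (Suc k) * norm ((real n ^ 1 * q ^ n) * expansion_scale q k n)"
      using q by (simp add: expansion_scale_def abs_mult)
  qed
  also have "(\<lambda>n. (real n ^ 1 * q ^ n) * expansion_scale q k n) \<in> o(\<lambda>n. 1 * expansion_scale q k n)"
    by (rule landau_o.small.mult_right)
       (rule smalloI_tendsto[OF _ always_eventually], use tendsto_power_times_geometric[OF q, of 1] in auto)
  finally show ?thesis by simp
qed

lemma sum_weight_labeled_graphs:
  "(\<Sum>g\<in>labeled_graphs k. weight \<rho> g) = (\<rho> + 1) ^ (k choose 2)"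
  by (simp add: sum_labeled_graphs weight_def sum_power_card_Pow card_vertex_pairs)

section \<open>Bounding the truncation error in expectation\<close>

text \<open>A first moment bound: averaging the estimate for single graphs leaves the expected
  number of medium separated sets. Each \<open>k\<close>-set is separated with probability
  \<open>q ^ (k * (n - k))\<close>, one factor for each absent crossing pair.\<close>

lemma truncation_error_le:
  assumes m: "m \<ge> 1" and p: "0 < p" "p < 1" and q: "q = 1 - p" and \<rho>: "\<rho> = p / q"
    and r: "4 * r < n"
  shows "\<bar>measure_pmf.prob (erdos_renyi n p) {g. pi0 g = m} - (\<Sum>k\<le>r. P_coeff k m \<rho> * expansion_scale q k n)\<bar>
    \<le> (1 + 2 ^ r * (\<Sum>k\<le>r. real (n choose k))) * (\<Sum>k=r + 1..n div 2. real (n choose k) * q ^ (k * (n - k)))"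
    (is "?err \<le> ?B * ?N")
proof -
  let ?V = "{1..n}" and ?c = "q ^ (n choose 2)"
  let ?F = "\<lambda>K h E. \<Sum>S\<in>{S. separated ?V E S \<and> card S \<in> K}. h (pi0 (S, E \<inter> vertex_pairs S)) :: real"
  let ?T = "{r + 1..n div 2}"
  have q0: "0 < q" "q \<noteq> 0" and \<rho>0: "0 < \<rho>"
    using p q \<rho> by auto
  have \<rho>1: "\<rho> + 1 = 1 / q" using q0 q \<rho> by (simp add: field_simps)
  have "(\<Sum>k\<le>r. P_coeff k m \<rho> * expansion_scale q k n) =
      ?c * (\<Sum>E\<in>Pow (vertex_pairs ?V). \<rho> ^ card E * ?F {..r} (signed_binomial m) E)"
    unfolding P_coeff_eq expansion_scale_def
    by (rule sum_over_separated_sets[OF q0(2) \<rho>1, symmetric]) simp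
  then have "?err = \<bar>?c * (\<Sum>E\<in>Pow (vertex_pairs ?V). \<rho> ^ card E *
      (of_bool (pi0 (?V, E) = m) - ?F {..r} (signed_binomial m) E))\<bar>"
    unfolding prob_erdos_renyi[OF p q \<rho>]
    by (simp only: right_diff_distrib sum_subtractf)
  also have "\<dots> = ?c * \<bar>\<Sum>E\<in>Pow (vertex_pairs ?V). \<rho> ^ card E *
      (of_bool (pi0 (?V, E) = m) - ?F {..r} (signed_binomial m) E)\<bar>"
    using q0 by (simp add: abs_mult)
  also have "\<dots> \<le> ?c * (\<Sum>E\<in>Pow (vertex_pairs ?V). \<rho> ^ card E * (?B * ?F ?T (\<lambda>_. 1) E))"
  proof (intro mult_left_mono order_trans[OF sum_abs sum_mono])
    fix E assume "E \<in> Pow (vertex_pairs ?V)"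
    then have "\<bar>of_bool (pi0 (?V, E) = m) - ?F {..r} (signed_binomial m) E\<bar> \<le> ?B * ?F ?T (\<lambda>_. 1) E"
      using abs_truncation_error_le[OF m, of ?V E r] r by simp
    then show "\<bar>\<rho> ^ card E * (of_bool (pi0 (?V, E) = m) - ?F {..r} (signed_binomial m) E)\<bar>
        \<le> \<rho> ^ card E * (?B * ?F ?T (\<lambda>_. 1) E)"
      unfolding abs_mult using \<rho>0 by (simp add: mult_left_mono)
  qed (use q0 in auto)
  also have "\<dots> = ?B * (?c * (\<Sum>E\<in>Pow (vertex_pairs ?V). \<rho> ^ card E * ?F ?T (\<lambda>_. 1) E))"
    by (simp only: sum_distrib_left mult_ac)
  also have "?c * (\<Sum>E\<in>Pow (vertex_pairs ?V). \<rho> ^ card E * ?F ?T (\<lambda>_. 1) E) =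
      (\<Sum>k\<in>?T. (\<Sum>g\<in>labeled_graphs k. weight \<rho> g * 1) *
        (real (n choose k) * (q ^ (n * k) / q ^ (k * (k + 1) div 2))))"
    by (rule sum_over_separated_sets[OF q0(2) \<rho>1]) simp
  also have "\<dots> = ?N"
  proof (rule sum.cong[OF refl])
    fix k assume "k \<in> ?T"
    then have k: "k \<le> n" by (auto intro: order_trans[OF _ div_le_dividend])
    obtain d where n: "n = k + d" using k le_Suc_ex by blast
    \<comment> \<open>The total weight of all graphs on \<open>k\<close> vertices is
      \<open>1 / q ^ (k choose 2)\<close>; this splitting of \<open>n * k\<close> cancels it and the
      denominator.\<close>
    have "n * k = k * (n - k) + k * (k + 1) div 2 + (k choose 2)"
    proof -
      have "k * (k + 1) div 2 + (k choose 2) = k * k"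
        using choose_two_diff[of k k] by (simp add: binomial_eq_0 add.commute)
      then show ?thesis unfolding n by (simp add: algebra_simps)
    qed
    then have "q ^ (n * k) = q ^ (k * (n - k)) * q ^ (k * (k + 1) div 2) * q ^ (k choose 2)"
      by (simp only: power_add)
    then have "1 / q ^ (k choose 2) * (q ^ (n * k) / q ^ (k * (k + 1) div 2)) = q ^ (k * (n - k))"
      using q0 by simp
    moreover have "(\<Sum>g\<in>labeled_graphs k. weight \<rho> g * 1) = 1 / q ^ (k choose 2)"
      by (simp add: sum_weight_labeled_graphs \<rho>1 power_one_over)
    ultimately show "(\<Sum>g\<in>labeled_graphs k. weight \<rho> g * 1) *
        (real (n choose k) * (q ^ (n * k) / q ^ (k * (k + 1) div 2))) = real (n choose k) * q ^ (k * (n - k))"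
      by (metis mult.left_commute)
  qed
  finally show ?thesis .
qed

lemma binomial_le_power_real:
  assumes "k \<le> r" "r \<le> n"
  shows "real (n choose k) \<le> real n ^ r"
proof -
  have "n choose k \<le> n ^ k" using assms by (intro binomial_le_pow) simp
  also have "\<dots> \<le> n ^ r"
    using assms by (cases "n = 0") (auto intro: power_increasing)
  finally show ?thesis by (metis of_nat_le_iff of_nat_power)
qed

text \<open>For \<open>k \<le> 4 * s\<close> both factors are estimated directly. For larger
  \<open>k\<close>, \<open>n - k \<ge> n / 2\<close> gives a power of \<open>q\<close> of order at
  least \<open>n * k / 2\<close>: half of it absorbs \<open>n ^ k\<close>, and the other half is at
  most \<open>q ^ (s * n)\<close>.\<close>

lemma binomial_times_power_le:
  fixes q :: real
  assumes q: "0 < q" "q < 1" and n: "4 * s \<le> n" "0 < n" "real n ^ 4 * q ^ n \<le> 1"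
    and k: "s \<le> k" "2 * k \<le> n"
  shows "real (n choose k) * q ^ (k * (n - k)) \<le> real n ^ (4 * s) * q ^ (s * (n - 4 * s))"
proof (cases "k \<le> 4 * s")
  case True
  have "s * (n - 4 * s) \<le> k * (n - k)" using True k by (intro mult_mono) auto
  then have "q ^ (k * (n - k)) \<le> q ^ (s * (n - 4 * s))"
    using q by (intro power_decreasing) auto
  then show ?thesis
    using binomial_le_power_real[OF True n(1)] q by (intro mult_mono) auto
next
  case False
  \<comment> \<open>Fourth powers keep the exponents \<open>n * k / 2\<close> and
    \<open>n * k / 4\<close> integral.\<close>
  have "(real n ^ k * q ^ (k * (n - k))) ^ 4 = real n ^ (4 * k) * q ^ (4 * (k * (n - k)))"
    by (simp add: power_mult_distrib mult.commute flip: power_mult)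
  also have "\<dots> \<le> real n ^ (4 * k) * q ^ (n * k + n * k)"
  proof (intro mult_left_mono power_decreasing)
    have "n * k \<le> 2 * (n - k) * k" by (rule mult_right_mono) (use k in auto)
    also have "\<dots> = 2 * (k * (n - k))" by (simp add: mult_ac)
    finally show "n * k + n * k \<le> 4 * (k * (n - k))" by linarith
  qed (use q in auto)
  also have "\<dots> = (real n ^ 4 * q ^ n) ^ k * q ^ (n * k)"
    by (simp add: power_mult_distrib power_mult power_add)
  also have "\<dots> \<le> 1 * q ^ (n * k)"
    using q n by (intro mult_right_mono power_le_one) auto
  also have "\<dots> \<le> q ^ (4 * (s * n))"
    using False q by (simp add: power_decreasing mult.commute)
  also have "\<dots> = (q ^ (s * n)) ^ 4" by (simp add: mult.commute flip: power_mult)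
  finally have "real n ^ k * q ^ (k * (n - k)) \<le> q ^ (s * n)"
    using q by (subst (asm) power_mono_iff) auto
  moreover have "real (n choose k) * q ^ (k * (n - k)) \<le> real n ^ k * q ^ (k * (n - k))"
    using binomial_le_power_real[of k k n] k q by (intro mult_right_mono) auto
  moreover have "q ^ (s * n) \<le> q ^ (s * (n - 4 * s))"
    using q by (intro power_decreasing) auto
  moreover have "\<dots> \<le> real n ^ (4 * s) * q ^ (s * (n - 4 * s))"
    using q n by (simp add: one_le_power)
  ultimately show ?thesis by linarith
qed

text \<open>The first moment bound is polynomial in \<open>n\<close> times
  \<open>q ^ ((r + 1) * n)\<close>. Splitting off one \<open>q ^ n\<close> to absorb the polynomial
  leaves \<open>q ^ (n * r)\<close>, the decay of the scale of index \<open>r\<close>.\<close>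

lemma truncation_error_bigo:
  assumes m: "m \<ge> 1" and p: "0 < p" "p < 1" and q: "q = 1 - p" and \<rho>: "\<rho> = p / q"
  shows "(\<lambda>n. measure_pmf.prob (erdos_renyi n p) {g. pi0 g = m} - (\<Sum>k\<le>r. P_coeff k m \<rho> * expansion_scale q k n))
    \<in> O(expansion_scale q r)"
proof -
  \<comment> \<open>The exponent \<open>4 * s\<close> of \<open>binomial_times_power_le\<close> for
    \<open>s = r + 1\<close>.\<close>
  define K where "K = 4 * (r + 1)"
  define D where "D = 1 + 2 ^ r * real (r + 1)"
  have q01: "0 < q" "q < 1" using p q by auto
  have D: "D \<ge> 0" by (simp add: D_def)
  let ?d = "q ^ (r * (r + 1) div 2)"
  let ?err = "\<lambda>n. measure_pmf.prob (erdos_renyi n p) {g. pi0 g = m} - (\<Sum>k\<le>r. P_coeff k m \<rho> * expansion_scale q k n)"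
  have "eventually (\<lambda>n. norm (?err n) \<le> D / q ^ ((r + 1) * K) * ?d * norm (expansion_scale q r n)) sequentially"
    \<comment> \<open>The first condition feeds \<open>binomial_times_power_le\<close>. The exponent
      in the second collects \<open>n ^ r\<close> from the crude bound, \<open>n\<close> from the
      number of sizes \<open>k\<close>, and \<open>n ^ K\<close> from each summand.\<close>
    using eventually_power_times_geometric_le_1[OF q01, of 4, simplified]
      eventually_power_times_geometric_le_1[OF q01, of "r + (1 + K)", simplified]
      eventually_gt_at_top[of K]
  proof eventually_elim
    case (elim n)
    have n: "n \<ge> 1" "r \<le> n" "4 * r < n" "4 * (r + 1) \<le> n" "0 < n"
      using elim(3) by (auto simp: K_def)
    have "\<bar>?err n\<bar> \<le> (1 + 2 ^ r * (\<Sum>k\<le>r. real (n choose k))) *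
        (\<Sum>k=r + 1..n div 2. real (n choose k) * q ^ (k * (n - k)))"
      by (rule truncation_error_le[OF m p q \<rho> n(3)])
    also have "\<dots> \<le> (D * real n ^ r) * (real n * (real n ^ K * q ^ ((r + 1) * (n - K))))"
    proof (rule mult_mono)
      have "(\<Sum>k\<le>r. real (n choose k)) \<le> (\<Sum>k\<le>r. real n ^ r)"
        using n by (intro sum_mono binomial_le_power_real) auto
      then have "2 ^ r * (\<Sum>k\<le>r. real (n choose k)) \<le> 2 ^ r * (real (r + 1) * real n ^ r)"
        by (intro mult_left_mono) auto
      moreover have "1 \<le> real n ^ r" using n by (intro one_le_power) simp
      ultimately show "1 + 2 ^ r * (\<Sum>k\<le>r. real (n choose k)) \<le> D * real n ^ r"
        unfolding D_def distrib_right mult.assoc by linarith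
      have "(\<Sum>k=r + 1..n div 2. real (n choose k) * q ^ (k * (n - k)))
          \<le> (\<Sum>k=r + 1..n div 2. real n ^ K * q ^ ((r + 1) * (n - K)))"
        unfolding K_def
        by (intro sum_mono binomial_times_power_le[OF q01 n(4,5) elim(1)]) auto
      also have "\<dots> = real (card {r + 1..n div 2}) * (real n ^ K * q ^ ((r + 1) * (n - K)))"
        by simp
      also have "\<dots> \<le> real n * (real n ^ K * q ^ ((r + 1) * (n - K)))"
        using q01 by (intro mult_right_mono) auto
      finally show "(\<Sum>k=r + 1..n div 2. real (n choose k) * q ^ (k * (n - k)))
          \<le> real n * (real n ^ K * q ^ ((r + 1) * (n - K)))" .
    qed (use D q01 in \<open>auto intro!: sum_nonneg\<close>)
    also have "\<dots> = D * real n ^ (r + (1 + K)) * q ^ ((r + 1) * (n - K))"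
      by (simp add: power_add)
    also have "q ^ ((r + 1) * (n - K)) = q ^ n * q ^ (n * r) / q ^ ((r + 1) * K)"
    proof -
      have "(r + 1) * (n - K) + (r + 1) * K = (r + 1) * n"
        using elim(3) by (simp add: add_mult_distrib2[symmetric] del: add_mult_distrib2)
      also have "\<dots> = n + n * r" by simp
      finally have "q ^ ((r + 1) * (n - K)) * q ^ ((r + 1) * K) = q ^ n * q ^ (n * r)"
        by (simp only: flip: power_add)
      then show ?thesis using q01 by (simp add: eq_divide_eq)
    qed
    also have "D * real n ^ (r + (1 + K)) * (q ^ n * q ^ (n * r) / q ^ ((r + 1) * K)) =
        (real n ^ (r + (1 + K)) * q ^ n) * (D * q ^ (n * r) / q ^ ((r + 1) * K))"
      by simp
    also have "\<dots> \<le> 1 * (D * q ^ (n * r) / q ^ ((r + 1) * K))"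
      using elim(2) D q01 by (intro mult_right_mono) auto
    also have "\<dots> = D / q ^ ((r + 1) * K) * ?d * (1 * (q ^ (n * r) / ?d))"
      using q01 by simp
    also have "\<dots> \<le> D / q ^ ((r + 1) * K) * ?d * expansion_scale q r n"
    proof -
      have "1 \<le> real (n choose r)"
        using n(2) by (simp add: Suc_leI)
      then have "1 * (q ^ (n * r) / ?d) \<le> expansion_scale q r n"
        unfolding expansion_scale_def using q01 by (intro mult_right_mono) auto
      then show ?thesis using D q01 by (intro mult_left_mono) auto
    qed
    finally show ?case using q01 by (simp add: expansion_scale_def)
  qed
  then show ?thesis by (rule bigoI)
qed

theorem theorem4p2:
  fixes m :: nat and p q \<rho> :: real
  assumes "m \<ge> 1" and "0 < p" and "p < 1" and "q = 1 - p" and "\<rho> = p / q"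
  shows "asymp_expansion
           (\<lambda>n. measure_pmf.prob (erdos_renyi n p) {g. pi0 g = m})
           (\<lambda>k. P_coeff k m \<rho>)
           (\<lambda>k n. real (n choose k) * (q ^ (n * k) / q ^ (k * (k + 1) div 2)))"
proof -
  have q: "0 < q" "q < 1" using assms by auto
  let ?f = "\<lambda>n. measure_pmf.prob (erdos_renyi n p) {g. pi0 g = m}"
  have "(\<lambda>n. ?f n - (\<Sum>k\<le>r. P_coeff k m \<rho> * expansion_scale q k n)) \<in> O(expansion_scale q (Suc r))" for r
  proof -
    \<comment> \<open>Adding back the last term, itself of the order of the scale of index
      \<open>Suc r\<close>, shortens the sum to \<open>r\<close>.\<close>
    have "(\<lambda>n. (?f n - (\<Sum>k\<le>Suc r. P_coeff k m \<rho> * expansion_scale q k n)) + P_coeff (Suc r) m \<rho> * expansion_scale q (Suc r) n)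
        \<in> O(expansion_scale q (Suc r))"
      by (intro sum_in_bigo truncation_error_bigo assms) simp
    then show ?thesis by simp
  qed
  then have "asymp_expansion ?f (\<lambda>k. P_coeff k m \<rho>) (expansion_scale q)"
    using expansion_scale_Suc_smallo[OF q] by (simp add: asymp_expansion_def)
  then show ?thesis unfolding expansion_scale_def .
qed

end
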